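(* Let $N$ be a positive integer whose trajectory under the Collatz function reaches $1$, and let $t$ be the base of $N$. If $N=c^{-1}(2^t)$ and $N$ is not a power of two, then $P_N(-1)=0$.
   Context: The Collatz function is $c(N)=\frac{3N+1}{2}$ for $N$ odd and $c(N)=\frac N2$ for $N$ even. For a positive integer $M$, $c^{-1}(M)$ denotes the odd preimage of $M$ under $c$ (when it exists), i.e. $c^{-1}(M)=\frac{2M-1}{3}$. Let $N$ be a positive integer whose trajectory $N, c(N), c(c(N)),\dots$ reaches $1$. The total stopping time $n$ of $N$ is the least $k\ge 0$ such that the $k$-th iterate of $N$ under $c$ equals $1$. Set $c^0(N)=N$, $c^k(N)=c(c^{k-1}(N))$ for $1\le k\le n$, and $c^k(N)=0$ for $k>n$. The $N$-th Collatz polynomial is $P_N(z)=\sum_{k=0}^{n}c^k(N)z^k$. The base $t$ of $N$ is the logarithm to base $2$ of the first term in the sequence $c^0(N)=N, c^1(N), c^2(N),\dots$ that is a power of two (where $1=2^0$ counts as a power of two). *)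

theory Defs
  imports Main "HOL-Computational_Algebra.Polynomial"
begin

definition collatz :: "nat \<Rightarrow> nat" where
  "collatz N = (if odd N then (3 * N + 1) div 2 else N div 2)"

definition reaches_one :: "nat \<Rightarrow> bool" where
  "reaches_one N \<longleftrightarrow> (\<exists>k. (collatz ^^ k) N = 1)"

text \<open>Meaningful only for \<open>N\<close> with \<open>reaches_one N\<close>; the same holds for every notion built on it.\<close>

definition total_stopping_time :: "nat \<Rightarrow> nat" where
  "total_stopping_time N = (LEAST k. (collatz ^^ k) N = 1)"

text \<open>The truncated iterate \<open>c^k(N)\<close>: it is set to \<open>0\<close> once the trajectory has passed \<open>1\<close>.\<close>

definition collatz_term :: "nat \<Rightarrow> nat \<Rightarrow> nat" where
  "collatz_term N k = (if k \<le> total_stopping_time N then (collatz ^^ k) N else 0)"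

definition collatz_poly :: "nat \<Rightarrow> int poly" where
  "collatz_poly N = (\<Sum>k = 0..total_stopping_time N. monom (int (collatz_term N k)) k)"

definition power_of_two :: "nat \<Rightarrow> bool" where
  "power_of_two m \<longleftrightarrow> (\<exists>e. m = 2 ^ e)"

definition collatz_base :: "nat \<Rightarrow> nat" where
  "collatz_base N =
     (THE t. collatz_term N (LEAST k. power_of_two (collatz_term N k)) = 2 ^ t)"

text \<open>The odd preimage \<open>c\<^sup>-\<^sup>1(M)\<close>, with \<open>None\<close> when there is none.\<close>

definition odd_preimage :: "nat \<Rightarrow> nat option" where
  "odd_preimage M =
     (if \<exists>N. odd N \<and> collatz N = M then Some (THE N. odd N \<and> collatz N = M) else None)"

lemma collatz_odd_iff:
  assumes "odd N"
  shows "collatz N = M \<longleftrightarrow> 3 * N + 1 = 2 * M"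
  using assms unfolding collatz_def by (auto elim!: oddE)

lemma odd_preimage_eq_Some_iff:
  "odd_preimage M = Some N \<longleftrightarrow> odd N \<and> collatz N = M"
proof -
  have uniq: "N = N'" if "odd N" "collatz N = M" "odd N'" "collatz N' = M" for N N'
    using that by (simp add: collatz_odd_iff)
  have "(THE N. odd N \<and> collatz N = M) = N" if "odd N" "collatz N = M" for N
    using that uniq by (intro the_equality) auto
  then show ?thesis
    unfolding odd_preimage_def by auto
qed

end

theory Submission
  imports Defs
begin

text \<open>
  If \<open>N\<close> is the odd preimage of \<open>2 ^ t\<close>, then the trajectory of \<open>N\<close> is
  \<open>N, 2 ^ t, 2 ^ (t - 1), \<dots>, 2, 1\<close>, so \<open>P\<^sub>N(-1) = N - S\<close>, where
  \<open>S = 2 ^ t - 2 ^ (t - 1) + \<dots>\<close> is an alternating geometric sum. By lemma \<open>alternating_powers_of_two\<close>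
  it satisfies \<open>3 * S = 2 ^ (t + 1) + (-1) ^ t\<close>, whereas \<open>3 * N = 2 ^ (t + 1) - 1\<close> by the choice of
  \<open>N\<close>. Hence \<open>3 * (S - N) = 1 + (-1) ^ t\<close>; the right-hand side is \<open>0\<close> or \<open>2\<close>, and being divisible
  by \<open>3\<close> it is \<open>0\<close>, so \<open>S = N\<close>. The role of \<open>N\<close> not being a power of two is to exclude \<open>N = 1\<close>,
  whose trajectory is cut off before it reaches \<open>2 ^ t = 2\<close>.
\<close>

lemma funpow_collatz_power_of_two:
  "k \<le> t \<Longrightarrow> (collatz ^^ k) (2 ^ t) = 2 ^ (t - k)"
proof (induction k)
  case (Suc k)
  then have "t - k = Suc (t - Suc k)" by simp
  with Suc show ?case by (simp add: collatz_def)
qed simp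

lemma funpow_collatz_preimage:
  assumes "collatz N = 2 ^ t" "k \<le> t"
  shows "(collatz ^^ Suc k) N = 2 ^ (t - k)"
  using assms by (simp add: funpow_Suc_right funpow_collatz_power_of_two del: funpow.simps)

lemma total_stopping_time_preimage:
  assumes "collatz N = 2 ^ t" "N \<noteq> 1"
  shows "total_stopping_time N = Suc t"
  unfolding total_stopping_time_def
proof (rule Least_equality)
  show "(collatz ^^ Suc t) N = 1"
    using funpow_collatz_preimage[OF assms(1), of t] by simp
next
  fix k assume k: "(collatz ^^ k) N = 1"
  show "Suc t \<le> k"
  proof (cases k)
    case 0
    with k assms(2) show ?thesis by simp
  next
    case (Suc j)
    show ?thesis
    proof (rule ccontr)
      assume "\<not> Suc t \<le> k"
      with Suc have "j < t" by simp
      with funpow_collatz_preimage[OF assms(1), of j] k Suc show False by simp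
    qed
  qed
qed

lemma poly_collatz_poly:
  "poly (collatz_poly N) x = (\<Sum>k\<le>total_stopping_time N. int ((collatz ^^ k) N) * x ^ k)"
  unfolding collatz_poly_def
  by (auto simp: poly_sum poly_monom collatz_term_def atMost_atLeast0 intro!: sum.cong)

text \<open>This is \<open>(x - y) * (\<Sum>k\<le>t. x ^ (t - k) * y ^ k) = x ^ Suc t - y ^ Suc t\<close> for \<open>x = 2\<close> and
  \<open>y = -1\<close>. Not dividing by \<open>3\<close> keeps visible the divisibility that later forces \<open>t\<close> to be odd.\<close>

lemma alternating_powers_of_two:
  "3 * (\<Sum>k\<le>t. 2 ^ (t - k) * (-1) ^ k) = (2 ^ Suc t + (-1) ^ t :: int)"
proof (induction t)
  case (Suc t)
  have "(\<Sum>k\<le>t. 2 ^ (Suc t - k) * (-1) ^ k) = (2 * (\<Sum>k\<le>t. 2 ^ (t - k) * (-1) ^ k) :: int)"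
    by (auto simp: sum_distrib_left Suc_diff_le intro!: sum.cong)
  with Suc.IH show ?case by simp
qed simp

theorem mainTheorem4:
  fixes N t :: nat
  assumes "N > 0"
    and "reaches_one N"
    and "t = collatz_base N"
    and "odd_preimage (2 ^ t) = Some N"
    and "\<not> power_of_two N"
  shows "poly (collatz_poly N) (-1) = 0"
proof -
  have N: "odd N" "collatz N = 2 ^ t"
    using assms(4) by (simp_all add: odd_preimage_eq_Some_iff)
  have "N \<noteq> 1"
    using assms(5) unfolding power_of_two_def by (metis power_0)
  define S :: int where "S = (\<Sum>k\<le>t. 2 ^ (t - k) * (-1) ^ k)"
  have "poly (collatz_poly N) (-1) =
      int N + (\<Sum>k\<le>t. int ((collatz ^^ Suc k) N) * (-1) ^ Suc k)"
    unfolding poly_collatz_poly total_stopping_time_preimage[OF N(2) \<open>N \<noteq> 1\<close>]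
    by (simp add: sum.atMost_Suc_shift del: funpow.simps sum.atMost_Suc)
  also have "(\<Sum>k\<le>t. int ((collatz ^^ Suc k) N) * (-1) ^ Suc k) = - S"
    unfolding S_def sum_negf[symmetric]
    by (rule sum.cong) (simp_all add: funpow_collatz_preimage[OF N(2)] del: funpow.simps)
  finally have P: "poly (collatz_poly N) (-1) = int N - S" by simp
  have "3 * N + 1 = 2 * 2 ^ t"
    using N by (simp add: collatz_odd_iff)
  then have "int (3 * N + 1) = int (2 * 2 ^ t)" by (rule arg_cong)
  then have "3 * (S - int N) = 1 + (-1) ^ t"
    using alternating_powers_of_two[of t] by (simp add: S_def)
  moreover have "(-1) ^ t = (1 :: int) \<or> (-1) ^ t = (-1 :: int)"
    by (cases "even t") simp_all
  ultimately have "S = int N" by presburger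
  with P show ?thesis by simp
qed

end
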